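(* Let $G$ be a graph with diameter $2$ and $\chi(G)\geq 4$. Suppose that either $e(\Delta^2(G)-\Delta(G)+1)\leq 2^{\delta(G)}$, or $G$ is $k$-regular for some $k\geq 4$. Then $\chi_2(G)-\chi(G)\leq 1$.
   Context: Graphs are finite and simple. $\chi(G)$ denotes the chromatic number of $G$; $\Delta(G)$ and $\delta(G)$ denote the maximum and minimum degree of $G$, and $\Delta^2(G)=(\Delta(G))^2$; $e$ is the base of the natural logarithm. A dynamic $l$-coloring of $G$ is a proper vertex coloring of $G$ with colors in $\{1,\ldots,l\}$ such that for every vertex $v$ of degree at least $2$, at least two different colors appear on the neighbors of $v$. The dynamic chromatic number $\chi_2(G)$ is the smallest integer $l$ such that $G$ has a dynamic $l$-coloring. *)

theory Defs
  imports Complex_Main "Graph_Theory.Graph_Theory"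
begin

text \<open>
  Finite simple graphs are the symmetric digraphs of the locale \<^locale>\<open>graph\<close>: finite, without
  loops or parallel arcs, every edge being represented by its two opposite arcs.  Hence
  \<^const>\<open>out_degree\<close> is the ordinary vertex degree.
\<close>

definition neighbors :: "('a, 'b) pre_digraph \<Rightarrow> 'a \<Rightarrow> 'a set" where
  "neighbors G v = {u. v \<rightarrow>\<^bsub>G\<^esub> u}"

definition max_degree :: "('a, 'b) pre_digraph \<Rightarrow> nat" where
  "max_degree G = Max (out_degree G ` verts G)"

definition min_degree :: "('a, 'b) pre_digraph \<Rightarrow> nat" where
  "min_degree G = Min (out_degree G ` verts G)"

definition regular_graph :: "nat \<Rightarrow> ('a, 'b) pre_digraph \<Rightarrow> bool" where
  "regular_graph k G \<longleftrightarrow> (\<forall>v\<in>verts G. out_degree G v = k)"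

text \<open>
  With unit arc weights \<^const>\<open>wf_digraph.\<mu>\<close> is the usual distance.  The diameter is \<open>\<infinity>\<close> for
  disconnected graphs, and \<open>-\<infinity>\<close> for the graph without vertices.
\<close>

definition graph_diameter :: "('a, 'b) pre_digraph \<Rightarrow> ereal" where
  "graph_diameter G = (SUP u\<in>verts G. SUP v\<in>verts G. wf_digraph.\<mu> G (\<lambda>_. 1) u v)"

definition proper_coloring :: "('a, 'b) pre_digraph \<Rightarrow> nat \<Rightarrow> ('a \<Rightarrow> nat) \<Rightarrow> bool" where
  "proper_coloring G l c \<longleftrightarrow>
     (\<forall>v\<in>verts G. c v \<in> {1..l}) \<and> (\<forall>u v. u \<rightarrow>\<^bsub>G\<^esub> v \<longrightarrow> c u \<noteq> c v)"

definition dynamic_coloring :: "('a, 'b) pre_digraph \<Rightarrow> nat \<Rightarrow> ('a \<Rightarrow> nat) \<Rightarrow> bool" where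
  "dynamic_coloring G l c \<longleftrightarrow> proper_coloring G l c \<and>
     (\<forall>v\<in>verts G. out_degree G v \<ge> 2 \<longrightarrow> card (c ` neighbors G v) \<ge> 2)"

definition chromatic_number :: "('a, 'b) pre_digraph \<Rightarrow> nat" where
  "chromatic_number G = (LEAST l. \<exists>c. proper_coloring G l c)"

definition dynamic_chromatic_number :: "('a, 'b) pre_digraph \<Rightarrow> nat" where
  "dynamic_chromatic_number G = (LEAST l. \<exists>c. dynamic_coloring G l c)"

end

theory Submission
  imports Defs
begin

text \<open>
  Let \<open>c\<close> be an optimal proper coloring, with \<open>m\<close> colors and color classes \<open>V\<^sub>i\<close>.  Call a vertex
  \<open>u\<close> monochromatic if all its neighbors have the same color \<open>i\<close>.  Diameter 2 is then very
  restrictive: each vertex other than \<open>u\<close> that is not a neighbor of \<open>u\<close> is adjacent to a neighbor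
  of \<open>u\<close>, so it does not have color \<open>i\<close>, and therefore the neighborhood of \<open>u\<close> is exactly \<open>V\<^sub>i\<close>.
  Two monochromatic vertices with different neighborhood colors have no common neighbor, so they
  are adjacent; with three such colors \<open>i\<close>, \<open>j\<close>, \<open>k\<close> the third vertex would lie in both \<open>V\<^sub>i\<close> and
  \<open>V\<^sub>j\<close>.  Hence at most two colors \<open>i\<close>, \<open>j\<close> occur on monochromatic neighborhoods.

  Both hypotheses on the degrees serve only to give minimum degree at least 3, and then \<open>m + 1\<close>
  colors suffice for a dynamic coloring:

  \<^item> If only \<open>i\<close> occurs, give one vertex of \<open>V\<^sub>i\<close> the new color.
  \<^item> If \<open>i\<close> and \<open>j\<close> occur and some \<open>x \<in> V\<^sub>i\<close>, \<open>y \<in> V\<^sub>j\<close> are not adjacent, give both the new color.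
    No neighborhood is contained in \<open>{x, y}\<close>, because all degrees are at least 3.
  \<^item> Otherwise \<open>V\<^sub>i\<close> and \<open>V\<^sub>j\<close> are completely joined.  Take \<open>u\<close> with neighborhood \<open>V\<^sub>i\<close> and \<open>w\<close> with
    neighborhood \<open>V\<^sub>j\<close>, so that \<open>u \<in> V\<^sub>j\<close> and \<open>w \<in> V\<^sub>i\<close>.  Give \<open>u\<close> the new color and \<open>w\<close> any third
    old color \<open>k\<close>.  The neighbors of \<open>w\<close> then avoid color \<open>k\<close>, and each of them is adjacent to all
    of \<open>V\<^sub>i\<close>, hence sees color \<open>i\<close> besides \<open>k\<close>.  The neighbors of \<open>u\<close> see the new color, which
    only \<open>u\<close> has, and an old one.  The remaining vertices see the same colors as before, and
    none of them was monochromatic, since \<open>w \<in> V\<^sub>i\<close> and \<open>u \<in> V\<^sub>j\<close>.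
\<close>

section \<open>Degrees, diameter and the existence of colorings\<close>

lemma (in graph) adj_sym: "u \<rightarrow>\<^bsub>G\<^esub> v \<Longrightarrow> v \<rightarrow>\<^bsub>G\<^esub> u"
  by (rule arcs_ends_symmetric[OF sym_arcs])

lemma (in wf_digraph) neighbors_subset_verts: "neighbors G v \<subseteq> verts G"
  by (auto simp: neighbors_def)

lemma (in nomulti_digraph) out_degree_eq_card_neighbors:
  "out_degree G v = card (neighbors G v)"
proof -
  have "inj_on (head G) (out_arcs G v)"
    by (rule inj_onI) (auto intro: no_multi_arcs simp: arc_to_ends_def)
  moreover have "head G ` out_arcs G v = neighbors G v"
    by (auto simp: neighbors_def arcs_ends_conv)
  ultimately show ?thesis
    unfolding out_degree_def by (metis card_image)
qed

lemma (in graph) diameter_le_2D: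
  assumes "graph_diameter G \<le> 2" "u \<in> verts G" "v \<in> verts G"
  shows "u = v \<or> u \<rightarrow>\<^bsub>G\<^esub> v \<or> (\<exists>w. u \<rightarrow>\<^bsub>G\<^esub> w \<and> w \<rightarrow>\<^bsub>G\<^esub> v)"
proof -
  have "\<mu> (\<lambda>_. 1) u v \<le> graph_diameter G"
    unfolding graph_diameter_def using assms(2,3) by (meson SUP_upper2 order_refl)
  also have "\<dots> < ereal 3"
    using assms(1) by (rule le_less_trans) simp
  finally obtain p where p: "awalk u p v" "awalk_cost (\<lambda>_. 1) p < 3"
    unfolding \<mu>_def INF_less_iff by auto
  have "length p < 3"
    using p(2) by (simp add: awalk_cost_def sum_list_triv)
  then consider "p = []" | a where "p = [a]" | a b where "p = [a, b]"
    by (auto simp: less_Suc_eq numeral_3_eq_3 length_Suc_conv)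
  then show ?thesis
    using p(1) by cases (auto simp: awalk_def arcs_ends_conv)
qed

lemma (in graph) proper_coloring_chromatic_number:
  "\<exists>c. proper_coloring G (chromatic_number G) c"
proof -
  obtain h where h: "bij_betw h (verts G) {1..card (verts G)}"
    using ex_bij_betw_finite_nat[OF finite_verts]
    by (metis card_atLeastAtMost diff_Suc_1 finite_atLeastAtMost finite_same_card_bij finite_verts)
  have "h u \<noteq> h v" if "u \<rightarrow>\<^bsub>G\<^esub> v" for u v
    using that h adj_not_same by (metis adj_in_verts(1) adj_in_verts(2) bij_betw_imp_inj_on inj_onD)
  then have "proper_coloring G (card (verts G)) h"
    unfolding proper_coloring_def using bij_betwE[OF h] by blast
  then show ?thesis
    unfolding chromatic_number_def
    using LeastI[of "\<lambda>l. \<exists>c. proper_coloring G l c"] by blast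
qed

lemma (in graph) min_degree_le:
  assumes "v \<in> verts G"
  shows "min_degree G \<le> out_degree G v"
  unfolding min_degree_def using assms by (intro Min_le) auto

lemma (in graph) min_degree_le_max_degree:
  assumes "verts G \<noteq> {}"
  shows "min_degree G \<le> max_degree G"
  unfolding min_degree_def max_degree_def using assms by (intro Min_le Max_in) auto

text \<open>
  For \<open>\<delta> \<le> 1\<close> the left-hand side is at least \<open>e > 2\<close>; for \<open>\<delta> = 2\<close> it is at least \<open>3 e > 4\<close>.
\<close>
lemma three_le_if_exp_bound:
  fixes d D :: nat
  assumes "d \<le> D" and bound: "exp 1 * ((real D)\<^sup>2 - real D + 1) \<le> 2 ^ d"
  shows "3 \<le> d"
proof (rule ccontr)
  assume "\<not> 3 \<le> d"
  have e: "exp (1::real) > 2"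
    using exp_lower_Taylor_quadratic[of 1] by simp
  show False
  proof (cases "d = 2")
    case True
    then have "2 * 1 \<le> real D * (real D - 1)"
      using assms(1) by (intro mult_mono) auto
    then have "2 * 3 \<le> exp 1 * ((real D)\<^sup>2 - real D + 1)"
      using e by (intro mult_mono) (auto simp: power2_eq_square algebra_simps)
    with bound True show False by simp
  next
    case False
    with \<open>\<not> 3 \<le> d\<close> have "d \<le> 1" by simp
    then have "(2::real) ^ d \<le> 2 ^ 1"
      by (intro power_increasing) auto
    moreover have "0 \<le> real D * (real D - 1)"
      by (cases D) auto
    then have "exp 1 * 1 \<le> exp 1 * ((real D)\<^sup>2 - real D + 1)"
      by (intro mult_left_mono) (auto simp: power2_eq_square algebra_simps)
    ultimately show False
      using bound e by simp
  qed
qed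

section \<open>Monochromatic neighborhoods\<close>

text \<open>
  The neighbors of \<open>v\<close> all have color \<open>i\<close>.  Isolated vertices are excluded, so that \<open>i\<close> is
  determined by \<open>v\<close>.
\<close>
definition mono_nbhd :: "('a, 'b) pre_digraph \<Rightarrow> ('a \<Rightarrow> nat) \<Rightarrow> 'a \<Rightarrow> nat \<Rightarrow> bool" where
  "mono_nbhd G c v i \<longleftrightarrow> neighbors G v \<noteq> {} \<and> (\<forall>x\<in>neighbors G v. c x = i)"

lemma (in graph) dynamic_coloringI:
  assumes "proper_coloring G l c"
    and two: "\<And>v. v \<in> verts G \<Longrightarrow> \<exists>x y. v \<rightarrow>\<^bsub>G\<^esub> x \<and> v \<rightarrow>\<^bsub>G\<^esub> y \<and> c x \<noteq> c y"
  shows "dynamic_coloring G l c"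
proof -
  have "card (c ` neighbors G v) \<ge> 2" if v: "v \<in> verts G" for v
  proof -
    obtain x y where xy: "v \<rightarrow>\<^bsub>G\<^esub> x" "v \<rightarrow>\<^bsub>G\<^esub> y" "c x \<noteq> c y"
      using two[OF v] by blast
    have "card {c x, c y} \<le> card (c ` neighbors G v)"
      using xy finite_subset[OF neighbors_subset_verts finite_verts]
      by (intro card_mono) (auto simp: neighbors_def)
    with xy show ?thesis by simp
  qed
  with assms(1) show ?thesis
    by (simp add: dynamic_coloring_def)
qed

lemma not_mono_nbhdE:
  assumes "\<And>i. \<not> mono_nbhd G c v i" "neighbors G v \<noteq> {}"
  obtains x y where "v \<rightarrow>\<^bsub>G\<^esub> x" "v \<rightarrow>\<^bsub>G\<^esub> y" "c x \<noteq> c y"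
  using assms unfolding mono_nbhd_def neighbors_def by fast

lemma (in graph) mono_nbhd_adj_iff:
  assumes "graph_diameter G \<le> 2" "proper_coloring G m c"
    and "v \<in> verts G" "mono_nbhd G c v i"
  shows "v \<rightarrow>\<^bsub>G\<^esub> x \<longleftrightarrow> x \<in> verts G \<and> c x = i"
proof
  assume "v \<rightarrow>\<^bsub>G\<^esub> x"
  then show "x \<in> verts G \<and> c x = i"
    using assms(4) by (auto simp: mono_nbhd_def neighbors_def)
next
  assume x: "x \<in> verts G \<and> c x = i"
  obtain y where y: "v \<rightarrow>\<^bsub>G\<^esub> y" "c y = i"
    using assms(4) by (auto simp: mono_nbhd_def neighbors_def)
  have "\<not> (v \<rightarrow>\<^bsub>G\<^esub> w \<and> w \<rightarrow>\<^bsub>G\<^esub> x)" for w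
    using assms(2,4) x by (auto simp: mono_nbhd_def neighbors_def proper_coloring_def)
  moreover have "v \<noteq> x"
    using assms(2) x y by (auto simp: proper_coloring_def)
  ultimately show "v \<rightarrow>\<^bsub>G\<^esub> x"
    using diameter_le_2D[OF assms(1,3), of x] x by blast
qed

lemma (in graph) mono_nbhd_adj:
  assumes "graph_diameter G \<le> 2"
    and "v \<in> verts G" "mono_nbhd G c v i" "w \<in> verts G" "mono_nbhd G c w j" "i \<noteq> j"
  shows "v \<rightarrow>\<^bsub>G\<^esub> w"
proof -
  have "v \<noteq> w"
    using assms(3,5,6) by (auto simp: mono_nbhd_def)
  moreover have "\<not> (v \<rightarrow>\<^bsub>G\<^esub> z \<and> z \<rightarrow>\<^bsub>G\<^esub> w)" for z
    using assms(3,5,6) adj_sym by (auto simp: mono_nbhd_def neighbors_def)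
  ultimately show ?thesis
    using diameter_le_2D[OF assms(1,2,4)] by blast
qed

section \<open>Recoloring with one new color\<close>

text \<open>
  Giving an independent set \<open>T\<close> the new color only hurts a vertex whose whole neighborhood lies
  in \<open>T\<close>, as every other vertex that sees the new color sees an old one, too.  So it suffices
  that \<open>T\<close> contains no neighborhood and meets each monochromatic one.
\<close>
lemma (in graph) dynamic_coloring_recolor_independent:
  assumes c: "proper_coloring G m c"
    and indep: "\<And>x y. x \<in> T \<Longrightarrow> y \<in> T \<Longrightarrow> \<not> x \<rightarrow>\<^bsub>G\<^esub> y"
    and not_all: "\<And>v. v \<in> verts G \<Longrightarrow> \<not> neighbors G v \<subseteq> T"
    and hit: "\<And>v i. v \<in> verts G \<Longrightarrow> mono_nbhd G c v i \<Longrightarrow> neighbors G v \<inter> T \<noteq> {}"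
  shows "dynamic_coloring G (m + 1) (\<lambda>x. if x \<in> T then m + 1 else c x)"
    (is "dynamic_coloring G _ ?c")
proof (rule dynamic_coloringI)
  have range: "c x \<in> {1..m}" if "x \<in> verts G" for x
    using c that by (simp add: proper_coloring_def)
  have old: "c x \<noteq> m + 1" if "x \<in> verts G" for x
    using range[OF that] by auto
  have "?c x \<noteq> ?c y" if "x \<rightarrow>\<^bsub>G\<^esub> y" for x y
    using that c indep old[of x] old[of y] adj_in_verts[OF that]
    by (auto simp: proper_coloring_def)
  moreover have "?c x \<in> {1..m + 1}" if "x \<in> verts G" for x
    using range[OF that] by auto
  ultimately show "proper_coloring G (m + 1) ?c"
    by (simp add: proper_coloring_def)
next
  fix v assume v: "v \<in> verts G"
  obtain z where z: "v \<rightarrow>\<^bsub>G\<^esub> z" "z \<notin> T"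
    using not_all[OF v] by (auto simp: neighbors_def)
  have "c z \<noteq> m + 1"
    using c adj_in_verts(2)[OF z(1)] by (auto simp: proper_coloring_def)
  show "\<exists>x y. v \<rightarrow>\<^bsub>G\<^esub> x \<and> v \<rightarrow>\<^bsub>G\<^esub> y \<and> ?c x \<noteq> ?c y"
  proof (cases "neighbors G v \<inter> T = {}")
    case True
    obtain x y where "v \<rightarrow>\<^bsub>G\<^esub> x" "v \<rightarrow>\<^bsub>G\<^esub> y" "c x \<noteq> c y"
    proof (rule not_mono_nbhdE)
      show "\<not> mono_nbhd G c v i" for i
        using True hit[OF v] by blast
      show "neighbors G v \<noteq> {}"
        using z(1) by (auto simp: neighbors_def)
    qed
    with True show ?thesis
      by (auto simp: neighbors_def disjoint_iff)
  next
    case False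
    with z \<open>c z \<noteq> m + 1\<close> show ?thesis
      by (auto simp: neighbors_def)
  qed
qed

text \<open>
  The case in which the two color classes that occur as neighborhoods are completely joined.
\<close>
lemma (in graph) dynamic_coloring_recolor_joined:
  assumes diam: "graph_diameter G \<le> 2"
    and c: "proper_coloring G m c"
    and deg: "\<And>v. v \<in> verts G \<Longrightarrow> out_degree G v \<ge> 2"
    and u: "u \<in> verts G" "mono_nbhd G c u i"
    and w: "w \<in> verts G" "mono_nbhd G c w j"
    and "i \<noteq> j"
    and only: "\<And>v k. v \<in> verts G \<Longrightarrow> mono_nbhd G c v k \<Longrightarrow> k = i \<or> k = j"
    and join: "\<And>x y. x \<in> verts G \<Longrightarrow> y \<in> verts G \<Longrightarrow> c x = i \<Longrightarrow> c y = j \<Longrightarrow> x \<rightarrow>\<^bsub>G\<^esub> y"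
    and k: "k \<in> {1..m}" "k \<noteq> i" "k \<noteq> j"
  shows "dynamic_coloring G (m + 1) (c(w := k, u := m + 1))" (is "dynamic_coloring G _ ?c")
proof (rule dynamic_coloringI)
  note Nu = mono_nbhd_adj_iff[OF diam c u]
  note Nw = mono_nbhd_adj_iff[OF diam c w]
  have uw: "u \<rightarrow>\<^bsub>G\<^esub> w"
    by (rule mono_nbhd_adj[OF diam u w \<open>i \<noteq> j\<close>])
  have cu: "c u = j" and cw: "c w = i" and "u \<noteq> w"
    using uw adj_sym[OF uw] Nu Nw \<open>i \<noteq> j\<close> by auto
  have range: "c x \<in> {1..m}" if "x \<in> verts G" for x
    using c that by (simp add: proper_coloring_def)
  have new: "?c x = m + 1 \<longleftrightarrow> x = u" if "x \<in> verts G" for x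
    using range[OF that] k(1) by auto
  have "?c x \<noteq> ?c y" if xy: "x \<rightarrow>\<^bsub>G\<^esub> y" for x y
  proof -
    have "x \<in> verts G" "y \<in> verts G" "x \<noteq> y" "c x \<noteq> c y"
      using xy adj_in_verts[OF xy] adj_not_same c by (auto simp: proper_coloring_def)
    moreover have "c y = j" if "x = w"
      using xy that Nw by blast
    moreover have "c x = j" if "y = w"
      using adj_sym[OF xy] that Nw by blast
    ultimately show ?thesis
      using new[of x] new[of y] k by (auto split: if_splits)
  qed
  moreover have "?c x \<in> {1..m + 1}" if "x \<in> verts G" for x
    using range[OF that] k(1) by auto
  ultimately show "proper_coloring G (m + 1) ?c"
    by (simp add: proper_coloring_def)

  have other: "\<exists>y. v \<rightarrow>\<^bsub>G\<^esub> y \<and> y \<noteq> x" if "v \<in> verts G" for v x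
  proof (rule ccontr)
    assume "\<not> ?thesis"
    then have "neighbors G v \<subseteq> {x}"
      by (auto simp: neighbors_def)
    then have "card (neighbors G v) \<le> 1"
      using card_mono[of "{x}" "neighbors G v"] by simp
    with deg[OF that] show False
      by (simp add: out_degree_eq_card_neighbors)
  qed
  fix v assume v: "v \<in> verts G"
  consider "v \<rightarrow>\<^bsub>G\<^esub> u" | "v \<rightarrow>\<^bsub>G\<^esub> w" | "\<not> v \<rightarrow>\<^bsub>G\<^esub> u" "\<not> v \<rightarrow>\<^bsub>G\<^esub> w" by blast
  then show "\<exists>x y. v \<rightarrow>\<^bsub>G\<^esub> x \<and> v \<rightarrow>\<^bsub>G\<^esub> y \<and> ?c x \<noteq> ?c y"
  proof cases
    case 1
    then obtain y where "v \<rightarrow>\<^bsub>G\<^esub> y" "y \<noteq> u"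
      using other[OF v] by blast
    with 1 show ?thesis
      using new[of y] new[of u] u(1) adj_in_verts(2) by metis
  next
    case 2
    then have "c v = j"
      using adj_sym Nw by blast
    \<comment> \<open>\<open>w\<close> is not the only vertex of color \<open>i\<close>, since these vertices are the neighbors of \<open>u\<close>.\<close>
    obtain y where y: "u \<rightarrow>\<^bsub>G\<^esub> y" "y \<noteq> w"
      using other[OF u(1)] by blast
    then have "y \<in> verts G" "c y = i"
      using Nu by auto
    moreover have "v \<rightarrow>\<^bsub>G\<^esub> y"
      using join[OF _ v _ \<open>c v = j\<close>] adj_sym calculation by blast
    ultimately show ?thesis
      using 2 y(2) k(2) cu \<open>i \<noteq> j\<close> \<open>u \<noteq> w\<close> by (intro exI[of _ w] exI[of _ y]) auto
  next
    case 3
    have "\<not> mono_nbhd G c v l" for l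
      using 3 only[OF v] mono_nbhd_adj_iff[OF diam c v] cu cw u(1) w(1) by blast
    moreover have "neighbors G v \<noteq> {}"
      using other[OF v] by (auto simp: neighbors_def)
    ultimately obtain x y where "v \<rightarrow>\<^bsub>G\<^esub> x" "v \<rightarrow>\<^bsub>G\<^esub> y" "c x \<noteq> c y"
      by (rule not_mono_nbhdE)
    with 3 show ?thesis
      by (intro exI[of _ x] exI[of _ y]) auto
  qed
qed

section \<open>One extra color suffices\<close>

lemma (in graph) ex_dynamic_coloring_Suc:
  assumes diam: "graph_diameter G \<le> 2"
    and c: "proper_coloring G m c"
    and "m \<ge> 3"
    and deg: "\<And>v. v \<in> verts G \<Longrightarrow> out_degree G v \<ge> 3"
  shows "\<exists>c'. dynamic_coloring G (m + 1) c'"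
proof -
  have small: "\<not> neighbors G v \<subseteq> T" if "v \<in> verts G" "finite T" "card T \<le> 2" for v T
    using deg[OF that(1)] card_mono[OF that(2), of "neighbors G v"] that(3)
    by (auto simp: out_degree_eq_card_neighbors)
  have nbr: "\<exists>x\<in>verts G. c x = i" if "mono_nbhd G c v i" for v i
    using that neighbors_subset_verts by (fastforce simp: mono_nbhd_def)
  show ?thesis
  proof (cases "\<exists>u\<in>verts G. \<exists>i. mono_nbhd G c u i")
    case False
    then have "dynamic_coloring G (m + 1) (\<lambda>x. if x \<in> {} then m + 1 else c x)"
      using small[of _ "{}"] by (intro dynamic_coloring_recolor_independent[OF c]) auto
    then show ?thesis by blast
  next
    case True
    then obtain u i where u: "u \<in> verts G" "mono_nbhd G c u i" by blast
    obtain x where x: "x \<in> verts G" "c x = i"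
      using nbr[OF u(2)] by blast
    show ?thesis
    proof (cases "\<exists>w\<in>verts G. \<exists>j. mono_nbhd G c w j \<and> j \<noteq> i")
      case False
      have "neighbors G v \<inter> {x} \<noteq> {}" if "v \<in> verts G" "mono_nbhd G c v l" for v l
        using False that x mono_nbhd_adj_iff[OF diam c that] by (auto simp: neighbors_def)
      then have "dynamic_coloring G (m + 1) (\<lambda>z. if z \<in> {x} then m + 1 else c z)"
        using small[of _ "{x}"] adj_not_same
        by (intro dynamic_coloring_recolor_independent[OF c]) auto
      then show ?thesis by blast
    next
      case True
      then obtain w j where w: "w \<in> verts G" "mono_nbhd G c w j" and "i \<noteq> j" by blast
      have only: "l = i \<or> l = j" if v: "v \<in> verts G" "mono_nbhd G c v l" for v l
      proof (rule ccontr)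
        assume "\<not> ?thesis"
        then have "u \<rightarrow>\<^bsub>G\<^esub> v" "w \<rightarrow>\<^bsub>G\<^esub> v"
          using mono_nbhd_adj[OF diam u v] mono_nbhd_adj[OF diam w v] by auto
        then have "c v = i" "c v = j"
          using u(2) w(2) by (auto simp: mono_nbhd_def neighbors_def)
        with \<open>i \<noteq> j\<close> show False by simp
      qed
      show ?thesis
      proof (cases "\<forall>x\<in>verts G. \<forall>y\<in>verts G. c x = i \<longrightarrow> c y = j \<longrightarrow> x \<rightarrow>\<^bsub>G\<^esub> y")
        case False
        then obtain x y where xy: "x \<in> verts G" "y \<in> verts G" "c x = i" "c y = j" "\<not> x \<rightarrow>\<^bsub>G\<^esub> y"
          by blast
        have "neighbors G v \<inter> {x, y} \<noteq> {}" if "v \<in> verts G" "mono_nbhd G c v l" for v l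
          using only[OF that] xy mono_nbhd_adj_iff[OF diam c that] by (auto simp: neighbors_def)
        moreover have "\<not> a \<rightarrow>\<^bsub>G\<^esub> b" if "a \<in> {x, y}" "b \<in> {x, y}" for a b
          using that xy(5) adj_sym[of y x] adj_not_same by auto
        moreover have "\<not> neighbors G v \<subseteq> {x, y}" if "v \<in> verts G" for v
          using small[OF that, of "{x, y}"] by (simp add: card_insert_if)
        ultimately have "dynamic_coloring G (m + 1) (\<lambda>z. if z \<in> {x, y} then m + 1 else c z)"
          by (intro dynamic_coloring_recolor_independent[OF c])
        then show ?thesis by blast
      next
        case True
        have "\<not> {1..m} \<subseteq> {i, j}"
          using card_mono[of "{i, j}" "{1..m}"] \<open>m \<ge> 3\<close> \<open>i \<noteq> j\<close> by auto
        then obtain k where k: "k \<in> {1..m}" "k \<noteq> i" "k \<noteq> j" by blast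
        have "dynamic_coloring G (m + 1) (c(w := k, u := m + 1))"
        proof (rule dynamic_coloring_recolor_joined[OF diam c _ u w \<open>i \<noteq> j\<close> only _ k])
          show "out_degree G v \<ge> 2" if "v \<in> verts G" for v
            using deg[OF that] by simp
        qed (use True in auto)
        then show ?thesis by blast
      qed
    qed
  qed
qed

theorem corollary2:
  fixes G :: "('a, 'b) pre_digraph"
  assumes "Digraph.graph G"
    and "graph_diameter G = 2"
    and "chromatic_number G \<ge> 4"
    and "exp 1 * ((real (max_degree G))\<^sup>2 - real (max_degree G) + 1) \<le> 2 ^ min_degree G
         \<or> (\<exists>k\<ge>4. regular_graph k G)"
  shows "int (dynamic_chromatic_number G) - int (chromatic_number G) \<le> 1"
proof -
  interpret graph G by (rule assms(1))
  have deg: "out_degree G v \<ge> 3" if v: "v \<in> verts G" for v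
    using assms(4)
  proof
    assume "exp 1 * ((real (max_degree G))\<^sup>2 - real (max_degree G) + 1) \<le> 2 ^ min_degree G"
    then have "3 \<le> min_degree G"
      using three_le_if_exp_bound min_degree_le_max_degree v by blast
    with min_degree_le[OF v] show ?thesis by simp
  next
    assume "\<exists>k\<ge>4. regular_graph k G"
    with v show ?thesis by (auto simp: regular_graph_def)
  qed
  obtain c where "proper_coloring G (chromatic_number G) c"
    using proper_coloring_chromatic_number by blast
  then have "\<exists>c'. dynamic_coloring G (chromatic_number G + 1) c'"
    using assms(2,3) deg by (intro ex_dynamic_coloring_Suc) auto
  then have "dynamic_chromatic_number G \<le> chromatic_number G + 1"
    unfolding dynamic_chromatic_number_def by (rule Least_le)
  then show ?thesis by simp
qed

end
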